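(* Let $\mathbb{K}$ be an algebraically closed field of characteristic zero and let $A,B\in M_3(\mathbb{K})$. Then $$\det\bigl(I,\,A,\,A^2,\,B,\,B^2,\,AB,\,BA,\,[A,[A,B]],\,[B,[B,A]]\bigr)=-9\,\bigl(\det [A,B]\bigr)^2\,H([A,B]).$$ Consequently, if $\det[A,B]\neq 0$ and $H([A,B])\neq 0$, then the nine matrices $I, A, A^2, B, B^2, AB, BA, [A,[A,B]], [B,[B,A]]$ form a basis of $M_3(\mathbb{K})$ as a $\mathbb{K}$-vector space.
   Context: $M_3(\mathbb{K})$ denotes the algebra of $3\times 3$ matrices over $\mathbb{K}$, and $I$ is the $3\times 3$ identity matrix. For $X,Y\in M_3(\mathbb{K})$, $[X,Y]=XY-YX$ is the commutator. For $M\in M_3(\mathbb{K})$, $H(M):=\frac{\operatorname{tr}(M)^2-\operatorname{tr}(M^2)}{2}$. For nine matrices $M_1,\dots,M_9\in M_3(\mathbb{K})$, $\det(M_1,\dots,M_9)$ denotes the determinant of the $9\times 9$ matrix whose $j$-th column is the vector $\bigl((M_j)_{11},(M_j)_{12},(M_j)_{13},(M_j)_{21},(M_j)_{22},(M_j)_{23},(M_j)_{31},(M_j)_{32},(M_j)_{33}\bigr)^T$ of entries of $M_j$ listed in row-major order. *)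

theory Defs
  imports "Jordan_Normal_Form.Determinant" "HOL-Computational_Algebra.Polynomial"
begin

definition commutator :: "'a::comm_ring mat \<Rightarrow> 'a mat \<Rightarrow> 'a mat" where
  "commutator X Y = X * Y - Y * X"

definition mtrace :: "'a::comm_ring_1 mat \<Rightarrow> 'a" where
  "mtrace M = (\<Sum>i<dim_row M. M $$ (i, i))"

definition H :: "'a::field mat \<Rightarrow> 'a" where
  "H M = ((mtrace M)^2 - mtrace (M * M)) / 2"

definition det9 :: "'a::comm_ring_1 mat list \<Rightarrow> 'a" where
  "det9 Ms = det (mat 9 9 (\<lambda>(r, j). (Ms ! j) $$ (r div 3, r mod 3)))"

definition lin_comb9 :: "(nat \<Rightarrow> 'a::comm_ring_1) \<Rightarrow> 'a mat list \<Rightarrow> 'a mat" where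
  "lin_comb9 c Ms = mat 3 3 (\<lambda>ij. \<Sum>j<9. c j * (Ms ! j) $$ ij)"

definition is_basis_M3 :: "'a::field mat list \<Rightarrow> bool" where
  "is_basis_M3 Ms \<longleftrightarrow> length Ms = 9 \<and> set Ms \<subseteq> carrier_mat 3 3 \<and>
     (\<forall>c. lin_comb9 c Ms = 0\<^sub>m 3 3 \<longrightarrow> (\<forall>j<9. c j = 0)) \<and>
     (\<forall>M \<in> carrier_mat 3 3. \<exists>c. M = lin_comb9 c Ms)"

end

theory Submission
  imports Defs
begin

text \<open>Both sides are invariant under simultaneous conjugation: \<open>M \<mapsto> P M P\<^sup>-\<^sup>1\<close> acts on the nine coordinates
  as a Kronecker product of determinant 1. If the discriminant of the characteristic polynomial of \<open>A\<close>
  is nonzero, \<open>A\<close> may therefore be taken diagonal, and then the \<open>9 \<times> 9\<close> matrix factors into two sparse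
  matrices with determinants \<open>9 V\<^sup>2\<close> and \<open>- u\<^sup>2 S\<close>, where \<open>V\<close> is the Vandermonde product of the
  eigenvalues, \<open>V u = det [A, B]\<close> and \<open>S = H [A, B]\<close>. The general case follows by moving \<open>A\<close> along a line
  on which the discriminant vanishes only finitely often: both sides are polynomials in the
  parameter.\<close>

subsection \<open>Determinants of sparse matrices\<close>

text \<open>A column is a list of pairs (row index, entry). Repeated indices add up, and
  \<open>sparse_det\<close> is the Laplace expansion along the first column restricted to the listed rows, so that
  the simplifier never visits a vanishing minor.\<close>

definition sparse_entry :: "(nat \<times> 'a::comm_monoid_add) list \<Rightarrow> nat \<Rightarrow> 'a" where
  "sparse_entry c r = (\<Sum>(k, x) \<leftarrow> c. if k = r then x else 0)"

definition sparse_delete :: "nat \<Rightarrow> (nat \<times> 'a) list \<Rightarrow> (nat \<times> 'a) list" where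
  "sparse_delete i c = map (\<lambda>(k, x). (if k < i then k else k - 1, x)) (filter (\<lambda>(k, x). k \<noteq> i) c)"

fun sparse_det :: "(nat \<times> 'a::comm_ring_1) list list \<Rightarrow> 'a" where
  "sparse_det [] = 1"
| "sparse_det (c # cs) = (\<Sum>(k, x) \<leftarrow> c. (-1) ^ k * x * sparse_det (map (sparse_delete k) cs))"

definition sparse_mat :: "(nat \<times> 'a::comm_ring_1) list list \<Rightarrow> 'a mat" where
  "sparse_mat cs = mat (length cs) (length cs) (\<lambda>(r, j). sparse_entry (cs ! j) r)"

text \<open>Deleting row \<open>i\<close> moves every later row up by one, exactly as in a
  minor.\<close>

lemma sparse_entry_delete:
  "sparse_entry (sparse_delete i c) r = sparse_entry c (if r < i then r else Suc r)"
  by (induction c) (auto simp: sparse_entry_def sparse_delete_def)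

lemma sparse_delete_simps [simp]:
  "sparse_delete i [] = []"
  "sparse_delete i ((k, x) # c) =
    (if k = i then sparse_delete i c else (if k < i then k else k - 1, x) # sparse_delete i c)"
  by (auto simp: sparse_delete_def)

text \<open>Collapses a Laplace sum over all rows to the listed pairs; a repeated index contributes
  once per occurrence, by distributivity.\<close>

lemma sum_sparse_entry:
  fixes f :: "nat \<Rightarrow> 'a::comm_ring_1"
  assumes "\<And>k x. (k, x) \<in> set c \<Longrightarrow> k < n"
  shows "(\<Sum>r<n. sparse_entry c r * f r) = (\<Sum>(k, x) \<leftarrow> c. x * f k)"
  using assms
proof (induction c)
  case (Cons p c)
  obtain k x where p: "p = (k, x)" by (cases p)
  have "k < n" using Cons.prems[of k x] p by simp
  have "(\<Sum>r<n. sparse_entry (p # c) r * f r)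
      = (\<Sum>r<n. (if r = k then x * f r else 0)) + (\<Sum>r<n. sparse_entry c r * f r)"
    unfolding sum.distrib[symmetric]
    by (rule sum.cong) (auto simp: sparse_entry_def p algebra_simps)
  also have "(\<Sum>r<n. (if r = k then x * f r else 0)) = x * f k"
    using \<open>k < n\<close> by simp
  finally show ?case using Cons p by auto
qed (simp add: sparse_entry_def)

text \<open>Induction along the first column: its minors are again sparse matrices, and deleting a
  row keeps the remaining indices within the smaller dimension.\<close>

lemma det_sparse_mat:
  assumes "\<forall>c \<in> set cs. \<forall>(k, x) \<in> set c. k < length cs"
  shows "det (sparse_mat cs) = sparse_det cs"
  using assms
proof (induction cs rule: sparse_det.induct)
  case 1
  then show ?case by (simp add: sparse_mat_def)
next
  case (2 c cs)
  let ?n = "length cs" and ?M = "sparse_mat (c # cs)"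
  have M: "?M \<in> carrier_mat (Suc ?n) (Suc ?n)"
    by (simp add: sparse_mat_def)
  have del: "mat_delete ?M k 0 = sparse_mat (map (sparse_delete k) cs)" if "k < Suc ?n" for k
    by (rule eq_matI) (use that in \<open>auto simp: mat_delete_def sparse_mat_def sparse_entry_delete\<close>)
  have k: "k < Suc ?n" if "(k, x) \<in> set c" for k x
    using 2(2) that by auto
  have "\<forall>c' \<in> set (map (sparse_delete k) cs). \<forall>(k', x) \<in> set c'. k' < length (map (sparse_delete k) cs)"
    if "k < Suc ?n" for k
    using 2(2) that by (fastforce simp: sparse_delete_def split: if_splits)
  then have IH: "det (sparse_mat (map (sparse_delete k) cs)) = sparse_det (map (sparse_delete k) cs)"
    if "(k, x) \<in> set c" for k x
    using 2(1)[OF that] k[OF that] by simp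
  have "det ?M = (\<Sum>r<Suc ?n. ?M $$ (r, 0) * cofactor ?M r 0)"
    using laplace_expansion_column[OF M, of 0] by simp
  also have "\<dots> = (\<Sum>r<Suc ?n. sparse_entry c r * cofactor ?M r 0)"
    by (rule sum.cong) (auto simp: sparse_mat_def)
  also have "\<dots> = (\<Sum>(k, x) \<leftarrow> c. x * cofactor ?M k 0)"
    by (rule sum_sparse_entry) (use k in blast)
  also have "\<dots> = sparse_det (c # cs)"
    unfolding sparse_det.simps
    by (intro arg_cong[where f = sum_list] map_cong refl)
      (auto simp: cofactor_def del k IH algebra_simps)
  finally show ?case .
qed

section \<open>Explicit formulas in dimension 3 and enumeration of nine indices\<close>

lemma index_mult_mat3:
  assumes "X \<in> carrier_mat 3 3" "Y \<in> carrier_mat 3 3" "i < 3" "j < 3"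
  shows "(X * Y) $$ (i, j) = X $$ (i, 0) * Y $$ (0, j) + X $$ (i, 1) * Y $$ (1, j) + X $$ (i, 2) * Y $$ (2, j)"
  using assms by (auto simp: scalar_prod_def numeral_3_eq_3 numeral_2_eq_2)

lemma nat_less_3: "(i::nat) < 3 \<longleftrightarrow> i = 0 \<or> i = 1 \<or> i = 2"
  by auto

lemma nat_less_9: "(r::nat) < 9 \<longleftrightarrow> r \<in> {0, 1, 2, 3, 4, 5, 6, 7, 8}"
  by auto

lemma sum_9: "(\<Sum>k<9. f k) = f 0 + f 1 + f 2 + f 3 + f 4 + f 5 + f 6 + f 7 + f (8::nat)"
  for f :: "nat \<Rightarrow> 'a::comm_monoid_add"
  by (simp add: eval_nat_numeral add.assoc)

lemma det_3:
  assumes "X \<in> carrier_mat 3 3"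
  shows "det X =
    X $$ (0, 0) * (X $$ (1, 1) * X $$ (2, 2) - X $$ (2, 1) * X $$ (1, 2))
  - X $$ (1, 0) * (X $$ (0, 1) * X $$ (2, 2) - X $$ (2, 1) * X $$ (0, 2))
  + X $$ (2, 0) * (X $$ (0, 1) * X $$ (1, 2) - X $$ (1, 1) * X $$ (0, 2))"
proof -
  define cs where "cs = map (\<lambda>j. map (\<lambda>i. (i, X $$ (i, j))) [0, 1, 2]) [0, 1, 2]"
  have X: "X = sparse_mat cs"
    using assms
    by (intro eq_matI) (auto simp: sparse_mat_def cs_def sparse_entry_def less_Suc_eq eval_nat_numeral)
  have "det X = sparse_det cs"
    unfolding X by (rule det_sparse_mat) (simp add: cs_def)
  also have "\<dots> = X $$ (0, 0) * (X $$ (1, 1) * X $$ (2, 2) - X $$ (2, 1) * X $$ (1, 2))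
  - X $$ (1, 0) * (X $$ (0, 1) * X $$ (2, 2) - X $$ (2, 1) * X $$ (0, 2))
  + X $$ (2, 0) * (X $$ (0, 1) * X $$ (1, 2) - X $$ (1, 1) * X $$ (0, 2))"
    by (simp add: cs_def algebra_simps)
  finally show ?thesis .
qed

subsection \<open>The identity for diagonal matrices\<close>

abbreviation words9 :: "'a::comm_ring_1 mat \<Rightarrow> 'a mat \<Rightarrow> 'a mat list" where
  "words9 A B \<equiv> [1\<^sub>m 3, A, A * A, B, B * B, A * B, B * A,
     commutator A (commutator A B), commutator B (commutator B A)]"

lemma commutator_carrier [simp]:
  "X \<in> carrier_mat n n \<Longrightarrow> Y \<in> carrier_mat n n \<Longrightarrow> commutator X Y \<in> carrier_mat n n"
  by (auto simp: commutator_def)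

lemma index_commutator3:
  assumes "X \<in> carrier_mat 3 3" "Y \<in> carrier_mat 3 3" "i < 3" "j < 3"
  shows "commutator X Y $$ (i, j) = (X * Y) $$ (i, j) - (Y * X) $$ (i, j)"
  using assms by (auto simp: commutator_def)

lemma H_3:
  assumes "X \<in> carrier_mat 3 3"
  shows "H X = ((X $$ (0, 0) + X $$ (1, 1) + X $$ (2, 2))^2
    - ((X * X) $$ (0, 0) + (X * X) $$ (1, 1) + (X * X) $$ (2, 2))) / 2"
  using assms by (simp add: H_def mtrace_def eval_nat_numeral)

text \<open>For diagonal \<open>A\<close>, the \<open>9 \<times> 9\<close> matrix factors as \<open>W * K\<close>. The columns of \<open>W\<close> are the diagonal
  matrix units; for each pair \<open>(i, j) = (0, 1), (1, 2), (2, 0)\<close> the matrix with entries \<open>b i j\<close> at \<open>(i, j)\<close>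
  and \<open>b j i\<close> at \<open>(j, i)\<close>; and three matrices with entries \<open>(a i - a j) * b i j\<close> (only for the three pairs),
  \<open>b i k * b k j\<close> and \<open>a k * b i k * b k j\<close> at \<open>(i, j)\<close>, where \<open>k\<close> is the third index. The columns of \<open>K\<close>
  are the coordinates of the nine words in these.\<close>

lemma det9_words9_diagonal:
  fixes a :: "nat \<Rightarrow> 'a::field_char_0" and b :: "nat \<Rightarrow> nat \<Rightarrow> 'a"
  defines "A \<equiv> mat 3 3 (\<lambda>(i, j). if i = j then a i else 0)"
    and "B \<equiv> mat 3 3 (\<lambda>(i, j). b i j)"
  shows "det9 (words9 A B) = - 9 * (det (commutator A B))^2 * H (commutator A B)"
proof -
  define S where "S = (a 0 - a 1)^2 * b 0 1 * b 1 0 + (a 1 - a 2)^2 * b 1 2 * b 2 1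
    + (a 2 - a 0)^2 * b 2 0 * b 0 2"
  define V where "V = (a 0 - a 1) * (a 1 - a 2) * (a 2 - a 0)"
  define u where "u = b 0 1 * b 1 2 * b 2 0 - b 0 2 * b 2 1 * b 1 0"
  define Ws :: "(nat \<times> 'a) list list" where "Ws =
    [[(0, 1)], [(4, 1)], [(8, 1)],
     [(1, b 0 1), (3, b 1 0)], [(5, b 1 2), (7, b 2 1)], [(6, b 2 0), (2, b 0 2)],
     [(1, (a 0 - a 1) * b 0 1), (5, (a 1 - a 2) * b 1 2), (6, (a 2 - a 0) * b 2 0)],
     [(1, b 0 2 * b 2 1), (3, b 1 2 * b 2 0), (5, b 1 0 * b 0 2),
      (7, b 2 0 * b 0 1), (6, b 2 1 * b 1 0), (2, b 0 1 * b 1 2)],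
     [(1, a 2 * b 0 2 * b 2 1), (3, a 2 * b 1 2 * b 2 0), (5, a 0 * b 1 0 * b 0 2),
      (7, a 0 * b 2 0 * b 0 1), (6, a 1 * b 2 1 * b 1 0), (2, a 1 * b 0 1 * b 1 2)]]"
  \<comment> \<open>The entry of \<open>[B, [B, A]]\<close> at \<open>(i, j)\<close> is the sum over
    k of \<open>b i k * b k j * (a i + a j - 2 * a k)\<close>. For the third index k the last factor
    is \<open>(a 0 + a 1 + a 2) - 3 * a k\<close>, whence the coefficients at 7 and 8 in the last
    column; k = i and k = j together give
    \<open>(b i i - b j j) * (a j - a i) * b i j\<close>.\<close>
  define Ks :: "(nat \<times> 'a) list list" where "Ks =
    [[(0, 1), (1, 1), (2, 1)], [(0, a 0), (1, a 1), (2, a 2)], [(0, (a 0)^2), (1, (a 1)^2), (2, (a 2)^2)],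
     [(0, b 0 0), (1, b 1 1), (2, b 2 2), (3, 1), (4, 1), (5, 1)],
     [(0, b 0 0 * b 0 0 + b 0 1 * b 1 0 + b 0 2 * b 2 0),
      (1, b 1 0 * b 0 1 + b 1 1 * b 1 1 + b 1 2 * b 2 1),
      (2, b 2 0 * b 0 2 + b 2 1 * b 1 2 + b 2 2 * b 2 2),
      (3, b 0 0 + b 1 1), (4, b 1 1 + b 2 2), (5, b 2 2 + b 0 0), (7, 1)],
     [(0, a 0 * b 0 0), (1, a 1 * b 1 1), (2, a 2 * b 2 2), (3, a 1), (4, a 2), (5, a 0), (6, 1)],
     [(0, a 0 * b 0 0), (1, a 1 * b 1 1), (2, a 2 * b 2 2), (3, a 0), (4, a 1), (5, a 2), (6, -1)],
     [(3, (a 0 - a 1)^2), (4, (a 1 - a 2)^2), (5, (a 2 - a 0)^2)],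
     [(0, 2 * ((a 0 - a 1) * b 0 1 * b 1 0 + (a 0 - a 2) * b 0 2 * b 2 0)),
      (1, 2 * ((a 1 - a 0) * b 1 0 * b 0 1 + (a 1 - a 2) * b 1 2 * b 2 1)),
      (2, 2 * ((a 2 - a 0) * b 2 0 * b 0 2 + (a 2 - a 1) * b 2 1 * b 1 2)),
      (3, (b 0 0 - b 1 1) * (a 1 - a 0)), (4, (b 1 1 - b 2 2) * (a 2 - a 1)),
      (5, (b 2 2 - b 0 0) * (a 0 - a 2)), (7, a 0 + a 1 + a 2), (8, -3)]]"
  have A: "A \<in> carrier_mat 3 3" and B: "B \<in> carrier_mat 3 3"
    by (simp_all add: A_def B_def)
  have C: "commutator A B \<in> carrier_mat 3 3" "commutator B A \<in> carrier_mat 3 3"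
    using A B by simp_all
  have index: "A $$ (i, j) = (if i = j then a i else 0)" "B $$ (i, j) = b i j" if "i < 3" "j < 3" for i j
    using that by (simp_all add: A_def B_def)
  note entries = index_commutator3 index_mult_mat3 A B C index
  \<comment> \<open>Behind the expansion: the functional
    \<open>X i j * b j i - X j i * b i j\<close> of each pair kills the three pair columns and sends
    the last three columns to \<open>(a i - a j) * b i j * b j i\<close>, \<open>- u\<close> and
    \<open>- a k * u\<close>. The remaining 3 x 3 determinant is \<open>u^2 * S\<close> up to
    sign.\<close>
  have "det (sparse_mat Ws) = sparse_det Ws"
    by (rule det_sparse_mat) (simp add: Ws_def)
  also have "\<dots> = - (u^2 * S)"
    unfolding Ws_def S_def u_def by (simp del: One_nat_def) (simp add: algebra_simps power2_eq_square del: One_nat_def)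
  finally have W: "det (sparse_mat Ws) = - (u^2 * S)" .
  \<comment> \<open>Behind the expansion: the first three columns form a Vandermonde block. One
    factor 3 is the entry -3, alone in its row. The other arises because
    \<open>(a i - a j)^2\<close>, for fixed symmetric functions of the eigenvalues, is quadratic in
    the third eigenvalue with leading coefficient -3, which yields a second Vandermonde
    determinant.\<close>
  have "det (sparse_mat Ks) = sparse_det Ks"
    by (rule det_sparse_mat) (simp add: Ks_def)
  also have "\<dots> = 9 * V^2"
    unfolding Ks_def V_def by (simp del: One_nat_def) (simp add: algebra_simps power2_eq_square del: One_nat_def)
  finally have K: "det (sparse_mat Ks) = 9 * V^2" .
  have len: "length Ws = 9" "length Ks = 9"
    by (simp_all add: Ws_def Ks_def)
  have entry: "words9 A B ! j $$ (r div 3, r mod 3) = (\<Sum>k<9. sparse_entry (Ws ! k) r * sparse_entry (Ks ! j) k)"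
    if "r < 9" "j < 9" for r j
  proof -
    \<comment> \<open>Explicit index sets reduce the factorization to 81 polynomial
      identities.\<close>
    have "\<forall>r \<in> {0, 1, 2, 3, 4, 5, 6, 7, 8}. \<forall>j \<in> {0, 1, 2, 3, 4, 5, 6, 7, 8}.
      words9 A B ! j $$ (r div 3, r mod 3) = (\<Sum>k<9. sparse_entry (Ws ! k) r * sparse_entry (Ks ! j) k)"
      unfolding sum_9 Ws_def Ks_def
      by (simp add: entries sparse_entry_def del: index_mult_mat; simp add: algebra_simps power2_eq_square)
    then show ?thesis using that unfolding nat_less_9 by blast
  qed
  have "mat 9 9 (\<lambda>(r, j). words9 A B ! j $$ (r div 3, r mod 3)) = sparse_mat Ws * sparse_mat Ks"
  proof (rule eq_matI)
    fix r j assume "r < dim_row (sparse_mat Ws * sparse_mat Ks)" "j < dim_col (sparse_mat Ws * sparse_mat Ks)"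
    then have rj: "r < 9" "j < 9"
      by (simp_all add: sparse_mat_def len)
    then show "mat 9 9 (\<lambda>(r, j). words9 A B ! j $$ (r div 3, r mod 3)) $$ (r, j) = (sparse_mat Ws * sparse_mat Ks) $$ (r, j)"
      using entry[OF rj]
      by (simp add: sparse_mat_def len scalar_prod_def atLeast0LessThan del: nth_Cons_numeral)
  qed (simp_all add: sparse_mat_def len)
  then have "det9 (words9 A B) = det (sparse_mat Ws) * det (sparse_mat Ks)"
    unfolding det9_def by (metis (no_types, lifting) det_mult len mat_carrier sparse_mat_def)
  also have "\<dots> = - 9 * (V * u)^2 * S"
    unfolding W K by (simp add: power_mult_distrib)
  also have "V * u = det (commutator A B)"
    unfolding det_3[OF C(1)] V_def u_def by (simp add: entries algebra_simps del: index_mult_mat)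
  also have "S = H (commutator A B)"
    unfolding H_3[OF C(1)] S_def by (simp add: entries field_simps power2_eq_square del: index_mult_mat)
  finally show ?thesis .
qed

subsection \<open>Invariance under conjugation\<close>

lemma mtrace_mult_comm3:
  fixes X Y :: "'a::comm_ring_1 mat"
  assumes "X \<in> carrier_mat 3 3" "Y \<in> carrier_mat 3 3"
  shows "mtrace (X * Y) = mtrace (Y * X)"
proof -
  have tr: "mtrace Z = Z $$ (0, 0) + Z $$ (1, 1) + Z $$ (2, 2)" if "Z \<in> carrier_mat 3 3" for Z :: "'a mat"
    using that by (simp add: mtrace_def eval_nat_numeral)
  have "X * Y \<in> carrier_mat 3 3" "Y * X \<in> carrier_mat 3 3"
    using assms by auto
  then show ?thesis
    using assms by (simp add: tr index_mult_mat3 algebra_simps del: index_mult_mat)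
qed

text \<open>The splitting of an index into \<open>div 3\<close> and \<open>mod 3\<close> matches the
  row-major order used by \<open>det9\<close>.\<close>

definition kron3 :: "'a::comm_ring_1 mat \<Rightarrow> 'a mat \<Rightarrow> 'a mat" where
  "kron3 P Q = mat 9 9 (\<lambda>(r, s). P $$ (r div 3, s div 3) * Q $$ (r mod 3, s mod 3))"

lemma kron3_carrier [simp]: "kron3 P Q \<in> carrier_mat 9 9"
  by (simp add: kron3_def)

text \<open>Separates the action on row indices from the action on column indices, so that each
  determinant can be computed from three copies of one 3 x 3 matrix.\<close>

lemma kron3_eq_mult:
  assumes P: "P \<in> carrier_mat 3 3" and Q: "Q \<in> carrier_mat 3 3"
  shows "kron3 P Q = kron3 P (1\<^sub>m 3) * kron3 (1\<^sub>m 3) Q"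
proof (rule eq_matI)
  fix r s assume "r < dim_row (kron3 P (1\<^sub>m 3) * kron3 (1\<^sub>m 3) Q)" "s < dim_col (kron3 P (1\<^sub>m 3) * kron3 (1\<^sub>m 3) Q)"
  then have rs: "r < 9" "s < 9" by (simp_all add: kron3_def)
  have "\<forall>r \<in> {0, 1, 2, 3, 4, 5, 6, 7, 8}. \<forall>s \<in> {0, 1, 2, 3, 4, 5, 6, 7, 8}.
    kron3 P Q $$ (r, s) = (\<Sum>k<9. kron3 P (1\<^sub>m 3) $$ (r, k) * kron3 (1\<^sub>m 3) Q $$ (k, s))"
    unfolding sum_9 by (simp add: kron3_def)
  then have "kron3 P Q $$ (r, s) = (\<Sum>k<9. kron3 P (1\<^sub>m 3) $$ (r, k) * kron3 (1\<^sub>m 3) Q $$ (k, s))"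
    using rs unfolding nat_less_9 by blast
  then show "kron3 P Q $$ (r, s) = (kron3 P (1\<^sub>m 3) * kron3 (1\<^sub>m 3) Q) $$ (r, s)"
    using rs by (simp add: scalar_prod_def atLeast0LessThan kron3_def)
qed (simp_all add: kron3_def)

text \<open>The indices with a common residue mod 3 carry one copy of \<open>P\<close> each; hence
  the cube.\<close>

lemma det_kron3_one_right:
  assumes "P \<in> carrier_mat 3 3"
  shows "det (kron3 P (1\<^sub>m 3)) = (det P)^3"
proof -
  define cs where "cs = map (\<lambda>s. [(s mod 3, P $$ (0, s div 3)), (3 + s mod 3, P $$ (1, s div 3)),
    (6 + s mod 3, P $$ (2, s div 3))]) [0, 1, 2, 3, 4, 5, 6, 7, 8]"
  have "kron3 P (1\<^sub>m 3) = sparse_mat cs"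
  proof (rule eq_matI)
    fix r s assume "r < dim_row (sparse_mat cs)" "s < dim_col (sparse_mat cs)"
    then have rs: "r < 9" "s < 9" by (simp_all add: sparse_mat_def cs_def)
    have "\<forall>r \<in> {0, 1, 2, 3, 4, 5, 6, 7, 8}. \<forall>s \<in> {0, 1, 2, 3, 4, 5, 6, 7, 8}.
      kron3 P (1\<^sub>m 3) $$ (r, s) = sparse_entry (cs ! s) r"
      by (simp add: kron3_def cs_def sparse_entry_def)
    then have "kron3 P (1\<^sub>m 3) $$ (r, s) = sparse_entry (cs ! s) r"
      using rs unfolding nat_less_9 by blast
    then show "kron3 P (1\<^sub>m 3) $$ (r, s) = sparse_mat cs $$ (r, s)"
      using rs by (simp add: sparse_mat_def cs_def del: nth_Cons_numeral list.map)
  qed (simp_all add: sparse_mat_def cs_def kron3_def)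
  moreover have "det (sparse_mat cs) = sparse_det cs"
    by (rule det_sparse_mat) (simp add: cs_def)
  moreover have "sparse_det cs = (det P)^3"
    unfolding cs_def det_3[OF assms] by simp (simp add: algebra_simps power3_eq_cube)
  ultimately show ?thesis by simp
qed

text \<open>Here the matrix is block diagonal with three copies of \<open>Q\<close>.\<close>

lemma det_kron3_one_left:
  assumes "Q \<in> carrier_mat 3 3"
  shows "det (kron3 (1\<^sub>m 3) Q) = (det Q)^3"
proof -
  define cs where "cs = map (\<lambda>s. [(3 * (s div 3), Q $$ (0, s mod 3)), (3 * (s div 3) + 1, Q $$ (1, s mod 3)),
    (3 * (s div 3) + 2, Q $$ (2, s mod 3))]) [0, 1, 2, 3, 4, 5, 6, 7, 8]"
  have "kron3 (1\<^sub>m 3) Q = sparse_mat cs"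
  proof (rule eq_matI)
    fix r s assume "r < dim_row (sparse_mat cs)" "s < dim_col (sparse_mat cs)"
    then have rs: "r < 9" "s < 9" by (simp_all add: sparse_mat_def cs_def)
    have "\<forall>r \<in> {0, 1, 2, 3, 4, 5, 6, 7, 8}. \<forall>s \<in> {0, 1, 2, 3, 4, 5, 6, 7, 8}.
      kron3 (1\<^sub>m 3) Q $$ (r, s) = sparse_entry (cs ! s) r"
      by (simp add: kron3_def cs_def sparse_entry_def)
    then have "kron3 (1\<^sub>m 3) Q $$ (r, s) = sparse_entry (cs ! s) r"
      using rs unfolding nat_less_9 by blast
    then show "kron3 (1\<^sub>m 3) Q $$ (r, s) = sparse_mat cs $$ (r, s)"
      using rs by (simp add: sparse_mat_def cs_def del: nth_Cons_numeral list.map)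
  qed (simp_all add: sparse_mat_def cs_def kron3_def)
  moreover have "det (sparse_mat cs) = sparse_det cs"
    by (rule det_sparse_mat) (simp add: cs_def)
  moreover have "sparse_det cs = (det Q)^3"
    unfolding cs_def det_3[OF assms] by simp (simp add: algebra_simps power3_eq_cube)
  ultimately show ?thesis by simp
qed

lemma det_kron3:
  assumes "P \<in> carrier_mat 3 3" "Q \<in> carrier_mat 3 3"
  shows "det (kron3 P Q) = (det P * det Q)^3"
  using assms unfolding kron3_eq_mult[OF assms]
  by (simp add: det_mult[of _ 9] det_kron3_one_right det_kron3_one_left power_mult_distrib)

text \<open>On row-major coordinates, \<open>M\<close> to \<open>P * M * Q\<close> is left
  multiplication by \<open>kron3 P (transpose_mat Q)\<close>; transposition does not change the
  determinant.\<close>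

lemma det9_map_mult:
  assumes P: "P \<in> carrier_mat 3 3" and Q: "Q \<in> carrier_mat 3 3"
    and Ms: "set Ms \<subseteq> carrier_mat 3 3" and len: "length Ms = 9"
  shows "det9 (map (\<lambda>M. P * M * Q) Ms) = (det P * det Q)^3 * det9 Ms"
proof -
  let ?N = "mat 9 9 (\<lambda>(r, j). (Ms ! j) $$ (r div 3, r mod 3))"
  have QT: "transpose_mat Q \<in> carrier_mat 3 3" using Q by simp
  have "mat 9 9 (\<lambda>(r, j). (map (\<lambda>M. P * M * Q) Ms ! j) $$ (r div 3, r mod 3))
      = kron3 P (transpose_mat Q) * ?N"
  proof (rule eq_matI)
    fix r j assume "r < dim_row (kron3 P (transpose_mat Q) * ?N)" "j < dim_col (kron3 P (transpose_mat Q) * ?N)"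
    then have r: "r < 9" and j: "j < 9" by (simp_all add: kron3_def)
    define M where "M = Ms ! j"
    have M: "M \<in> carrier_mat 3 3" using Ms len j by (auto simp: M_def)
    have "(P * M * Q) $$ (r div 3, r mod 3) = (\<Sum>k<9. kron3 P (transpose_mat Q) $$ (r, k) * M $$ (k div 3, k mod 3))"
      using r Q P M unfolding sum_9
      by (simp add: kron3_def index_mult_mat3[of _ Q] index_mult_mat3[of P] less_mult_imp_div_less numeral_2_eq_2 algebra_simps del: index_mult_mat)
    then show "mat 9 9 (\<lambda>(r, j). (map (\<lambda>M. P * M * Q) Ms ! j) $$ (r div 3, r mod 3)) $$ (r, j)
        = (kron3 P (transpose_mat Q) * ?N) $$ (r, j)"
      using r j len by (simp add: scalar_prod_def atLeast0LessThan kron3_def M_def)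
  qed (simp_all add: kron3_def)
  then show ?thesis
    unfolding det9_def using det_mult[of "kron3 P (transpose_mat Q)" 9 ?N] det_kron3[OF P QT] det_transpose[OF Q]
    by simp
qed

text \<open>Conjugation respects products and commutators, so it carries the nine words of
  \<open>X\<close>, \<open>Y\<close> to those of \<open>A\<close>, \<open>B\<close>. The factor on
  \<open>det9\<close> is \<open>(det P * det Q)^3 = 1\<close>, and \<open>H\<close> is preserved
  because the trace is cyclic.\<close>

lemma det9_identity_conj:
  fixes P Q X Y :: "'a::field mat"
  assumes P: "P \<in> carrier_mat 3 3" and Q: "Q \<in> carrier_mat 3 3" and X: "X \<in> carrier_mat 3 3" and Y: "Y \<in> carrier_mat 3 3"
    and PQ: "P * Q = 1\<^sub>m 3" and QP: "Q * P = 1\<^sub>m 3"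
    and id: "det9 (words9 X Y) = - 9 * (det (commutator X Y))^2 * H (commutator X Y)"
  defines "A \<equiv> P * X * Q" and "B \<equiv> P * Y * Q"
  shows "det9 (words9 A B) = - 9 * (det (commutator A B))^2 * H (commutator A B)"
proof -
  let ?cj = "\<lambda>M. P * M * Q"
  have mult: "?cj M * ?cj N = ?cj (M * N)" if M: "M \<in> carrier_mat 3 3" and N: "N \<in> carrier_mat 3 3" for M N
  proof -
    have "?cj M * ?cj N = P * M * (Q * P) * N * Q"
      using P Q M N by (simp add: assoc_mult_mat[of _ 3 3 _ 3 _ 3])
    then show ?thesis
      using P Q M N by (simp add: QP assoc_mult_mat[of _ 3 3 _ 3 _ 3])
  qed
  have comm: "commutator (?cj M) (?cj N) = ?cj (commutator M N)"
    if M: "M \<in> carrier_mat 3 3" and N: "N \<in> carrier_mat 3 3" for M N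
  proof -
    have "?cj (M * N - N * M) = ?cj (M * N) - ?cj (N * M)"
      using mult_minus_distrib_mat[OF P mult_carrier_mat[OF M N] mult_carrier_mat[OF N M]]
        minus_mult_distrib_mat[OF mult_carrier_mat[OF P mult_carrier_mat[OF M N]]
          mult_carrier_mat[OF P mult_carrier_mat[OF N M]] Q]
      by simp
    then show ?thesis
      unfolding commutator_def mult[OF M N] mult[OF N M] by simp
  qed
  have one: "?cj (1\<^sub>m 3) = 1\<^sub>m 3"
    using P Q PQ by simp
  have dPQ: "det P * det Q = 1"
    using det_mult[OF P Q] PQ by simp
  have C: "commutator X Y \<in> carrier_mat 3 3"
    using X Y by simp
  have "words9 A B = map ?cj (words9 X Y)"
    unfolding A_def B_def using X Y by (simp add: mult comm one P Q PQ)
  then have "det9 (words9 A B) = det9 (words9 X Y)"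
    using det9_map_mult[OF P Q, of "words9 X Y"] X Y dPQ by (simp only:) simp
  moreover have "det (commutator A B) = det (commutator X Y)"
    unfolding A_def B_def comm[OF X Y]
    using det_mult[of "P * commutator X Y" 3 Q] det_mult[OF P C] P Q C dPQ
    by (simp add: algebra_simps)
  moreover have tr: "mtrace (?cj M) = mtrace M" if M: "M \<in> carrier_mat 3 3" for M
  proof -
    have "mtrace (?cj M) = mtrace (Q * (P * M))"
      using mtrace_mult_comm3[of "P * M" Q] P Q M by simp
    also have "Q * (P * M) = M"
      using assoc_mult_mat[OF Q P M] QP M by simp
    finally show ?thesis .
  qed
  then have "H (commutator A B) = H (commutator X Y)"
    unfolding A_def B_def comm[OF X Y] H_def mult[OF C C] using C by simp
  ultimately show ?thesis
    using id by simp
qed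

subsection \<open>Diagonalization\<close>

text \<open>\<open>H A\<close> is the second elementary symmetric function of the eigenvalues, hence
  the linear coefficient.\<close>

lemma det_char_matrix3:
  fixes A :: "'a::field_char_0 mat"
  assumes "A \<in> carrier_mat 3 3"
  shows "det (x \<cdot>\<^sub>m 1\<^sub>m 3 - A) = x^3 - mtrace A * x^2 + H A * x - det A"
proof -
  have tr: "mtrace A = A $$ (0, 0) + A $$ (1, 1) + A $$ (2, 2)"
    using assms by (simp add: mtrace_def eval_nat_numeral)
  have M: "x \<cdot>\<^sub>m 1\<^sub>m 3 - A \<in> carrier_mat 3 3"
    by (rule minus_carrier_mat[OF assms])
  show ?thesis
    unfolding det_3[OF M] det_3[OF assms] H_3[OF assms] tr using assms
    by (simp add: index_mult_mat3 field_simps power2_eq_square power3_eq_cube del: index_mult_mat(1))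
qed

text \<open>The discriminant of the characteristic polynomial
  \<open>x^3 - mtrace M * x^2 + H M * x - det M\<close>.\<close>

definition disc3 :: "'a::field mat \<Rightarrow> 'a" where
  "disc3 M = (mtrace M)^2 * (H M)^2 - 4 * (H M)^3 - 4 * (mtrace M)^3 * det M
     + 18 * mtrace M * H M * det M - 27 * (det M)^2"

text \<open>The characteristic polynomial splits into three linear factors; by Vieta's formulas
  \<open>disc3 A\<close> is the square of the Vandermonde product of its roots.\<close>

lemma disc3_nonzero_imp_distinct_eigenvalues:
  fixes A :: "'a::{alg_closed_field, field_char_0} mat"
  assumes A: "A \<in> carrier_mat 3 3" and d: "disc3 A \<noteq> 0"
  obtains x y z where "x \<noteq> y" "y \<noteq> z" "z \<noteq> x"
    "\<And>t. t \<in> {x, y, z} \<Longrightarrow> det (t \<cdot>\<^sub>m 1\<^sub>m 3 - A) = 0"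
proof -
  define p where "p = [:- det A, H A, - mtrace A, 1:]"
  have p: "poly p t = det (t \<cdot>\<^sub>m 1\<^sub>m 3 - A)" for t
    unfolding det_char_matrix3[OF A] p_def by (simp add: algebra_simps power2_eq_square power3_eq_cube)
  have "p \<noteq> 0" "degree p = 3" "lead_coeff p = 1"
    by (simp_all add: p_def)
  then obtain R where "size R = 3" and R: "p = (\<Prod>x\<in>#R. [:-x, 1:])"
    using alg_closed_imp_factorization[of p] by auto
  then obtain x y z where "R = {#x, y, z#}"
    by (metis numeral_3_eq_3 size_eq_Suc_imp_eq_union size_eq_0_iff_empty nat.inject size_add_mset)
  then have p_eq: "p = [:-x, 1:] * [:-y, 1:] * [:-z, 1:]"
    using R by (simp add: algebra_simps)
  have "coeff p 0 = - (x * y * z)" "coeff p 1 = x * y + y * z + z * x" "- coeff p 2 = x + y + z"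
    unfolding p_eq by (simp_all add: eval_nat_numeral algebra_simps)
  then have e: "mtrace A = x + y + z" "H A = x * y + y * z + z * x" "det A = x * y * z"
    by (simp_all add: p_def eval_nat_numeral)
  have "disc3 A = ((x - y) * (y - z) * (z - x))^2"
    unfolding disc3_def e by (simp add: algebra_simps power2_eq_square power3_eq_cube)
  then have "x \<noteq> y" "y \<noteq> z" "z \<noteq> x"
    using d by auto
  moreover have "det (t \<cdot>\<^sub>m 1\<^sub>m 3 - A) = 0" if "t \<in> {x, y, z}" for t
    using that unfolding p[symmetric] p_eq poly_mult by auto
  ultimately show thesis
    using that by blast
qed

lemma vandermonde3_zero:
  fixes x y z p q r :: "'a::field"
  assumes "x \<noteq> y" "z \<noteq> x"
    and "p + q + r = 0" "x * p + y * q + z * r = 0" "x * (x * p) + y * (y * q) + z * (z * r) = 0"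
  shows "p = 0"
proof -
  \<comment> \<open>The weights are the coefficients of \<open>(t - y) * (t - z)\<close>, which
    vanishes at \<open>y\<close> and \<open>z\<close> but not at \<open>x\<close>.\<close>
  have "(x - y) * (x - z) * p = (x * (x * p) + y * (y * q) + z * (z * r))
      - (y + z) * (x * p + y * q + z * r) + y * z * (p + q + r)"
    by (simp add: algebra_simps)
  also have "\<dots> = 0"
    unfolding assms(3-5) by simp
  finally show ?thesis
    using assms(1,2) by simp
qed

text \<open>The columns of \<open>P\<close> are eigenvectors for the three distinct eigenvalues, so
  \<open>A * P = P * D\<close>; their independence makes \<open>P\<close> invertible.\<close>

lemma disc3_nonzero_imp_diagonalizable:
  fixes A :: "'a::{alg_closed_field, field_char_0} mat"
  assumes A: "A \<in> carrier_mat 3 3" and d: "disc3 A \<noteq> 0"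
  obtains P Q l where "P \<in> carrier_mat 3 3" "Q \<in> carrier_mat 3 3" "P * Q = 1\<^sub>m 3" "Q * P = 1\<^sub>m 3"
    "A = P * mat 3 3 (\<lambda>(i, j). if i = j then l i else 0) * Q"
proof -
  obtain x y z where ne: "x \<noteq> y" "y \<noteq> z" "z \<noteq> x"
    and ev: "\<And>t. t \<in> {x, y, z} \<Longrightarrow> det (t \<cdot>\<^sub>m 1\<^sub>m 3 - A) = 0"
    using disc3_nonzero_imp_distinct_eigenvalues[OF A d] by blast
  have "\<exists>v. v \<in> carrier_vec 3 \<and> v \<noteq> 0\<^sub>v 3 \<and> A *\<^sub>v v = t \<cdot>\<^sub>v v" if t: "t \<in> {x, y, z}" for t
  proof -
    have "t \<cdot>\<^sub>m 1\<^sub>m 3 - A \<in> carrier_mat 3 3" by (rule minus_carrier_mat[OF A])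
    from det_0_iff_vec_prod_zero_field[OF this] ev[OF t]
    obtain v where v: "v \<in> carrier_vec 3" "v \<noteq> 0\<^sub>v 3" "(t \<cdot>\<^sub>m 1\<^sub>m 3 - A) *\<^sub>v v = 0\<^sub>v 3"
      by auto
    have "(t \<cdot>\<^sub>m 1\<^sub>m 3 - A) *\<^sub>v v = t \<cdot>\<^sub>v v - A *\<^sub>v v"
      using minus_mult_distrib_mat_vec[of "t \<cdot>\<^sub>m 1\<^sub>m 3" 3 3 A v] A v by auto
    then have eq: "t \<cdot>\<^sub>v v - A *\<^sub>v v = 0\<^sub>v 3"
      using v by simp
    have "A *\<^sub>v v = t \<cdot>\<^sub>v v"
    proof (rule eq_vecI)
      fix i assume "i < dim_vec (t \<cdot>\<^sub>v v)"
      then have "i < 3" using v by simp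
      then have "(t \<cdot>\<^sub>v v - A *\<^sub>v v) $ i = 0"
        using eq by simp
      then show "(A *\<^sub>v v) $ i = (t \<cdot>\<^sub>v v) $ i"
        using A v \<open>i < 3\<close> by simp
    qed (use A v in auto)
    then show ?thesis using v by blast
  qed
  then obtain v where v: "\<And>t. t \<in> {x, y, z} \<Longrightarrow> v t \<in> carrier_vec 3 \<and> v t \<noteq> 0\<^sub>v 3 \<and> A *\<^sub>v v t = t \<cdot>\<^sub>v v t"
    by metis
  define l where "l i = (if i = 0 then x else if i = 1 then y else z)" for i :: nat
  have l: "l i \<in> {x, y, z}" for i
    by (simp add: l_def)
  define P where "P = mat 3 3 (\<lambda>(i, k). v (l k) $ i)"
  define D where "D = mat 3 3 (\<lambda>(i, j). if i = j then l i else 0)"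
  have P: "P \<in> carrier_mat 3 3" and D: "D \<in> carrier_mat 3 3"
    by (simp_all add: P_def D_def)
  have AP: "A * P = P * D"
  proof (rule eq_matI)
    fix i k assume "i < dim_row (P * D)" "k < dim_col (P * D)"
    then have ik: "i < 3" "k < 3" using P D by simp_all
    have "col P k = v (l k)"
      using v[OF l[of k]] ik by (intro eq_vecI) (auto simp: P_def)
    then have "(A * P) $$ (i, k) = (A *\<^sub>v v (l k)) $ i"
      using A P ik by simp
    also have "\<dots> = l k * P $$ (i, k)"
      using v[OF l[of k]] ik by (auto simp: P_def)
    also have "\<dots> = (P * D) $$ (i, k)"
      using ik P D by (auto simp: index_mult_mat3 D_def nat_less_3 simp del: index_mult_mat(1))
    finally show "(A * P) $$ (i, k) = (P * D) $$ (i, k)" .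
  qed (use A P D in auto)
  have "det P \<noteq> 0"
  proof
    assume "det P = 0"
    with det_0_iff_vec_prod_zero_field[OF P] obtain c where
      c: "c \<in> carrier_vec 3" "c \<noteq> 0\<^sub>v 3" and Pc: "P *\<^sub>v c = 0\<^sub>v 3" by auto
    \<comment> \<open>The kernel of \<open>P\<close> is stable under \<open>D\<close>. Applying this
      to \<open>c\<close> and \<open>D *\<^sub>v c\<close> gives, in each coordinate, a Vandermonde
      system for the three weighted eigenvector entries.\<close>
    have Dv: "P *\<^sub>v (D *\<^sub>v w) = 0\<^sub>v 3" if w: "w \<in> carrier_vec 3" and "P *\<^sub>v w = 0\<^sub>v 3" for w
    proof -
      have "P *\<^sub>v (D *\<^sub>v w) = A *\<^sub>v (P *\<^sub>v w)"
        using assoc_mult_mat_vec[OF P D w] assoc_mult_mat_vec[OF A P w] AP by simp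
      also have "\<dots> = 0\<^sub>v 3"
        using that A by (intro eq_vecI) auto
      finally show ?thesis .
    qed
    have Dc: "D *\<^sub>v c \<in> carrier_vec 3"
      using D c by simp
    have mv: "(P *\<^sub>v w) $ i = v x $ i * w $ 0 + v y $ i * w $ 1 + v z $ i * w $ 2" if "w \<in> carrier_vec 3" "i < 3" for w i
      using that P by (simp add: scalar_prod_def P_def l_def eval_nat_numeral)
    have Dw: "(D *\<^sub>v w) $ i = l i * w $ i" if "w \<in> carrier_vec 3" "i < 3" for w i
      using that by (auto simp: scalar_prod_def D_def numeral_3_eq_3 less_Suc_eq)
    have zero: "v x $ i * c $ 0 = 0 \<and> v y $ i * c $ 1 = 0 \<and> v z $ i * c $ 2 = 0" if i: "i < 3" for i
    proof -
      have 1: "v x $ i * c $ 0 + v y $ i * c $ 1 + v z $ i * c $ 2 = 0"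
        using mv[OF c(1) i] Pc i by simp
      have 2: "v x $ i * (x * c $ 0) + v y $ i * (y * c $ 1) + v z $ i * (z * c $ 2) = 0"
        using mv[OF Dc i] Dv[OF c(1) Pc] i c by (simp add: Dw l_def del: index_mult_mat_vec)
      have 3: "v x $ i * (x * (x * c $ 0)) + v y $ i * (y * (y * c $ 1)) + v z $ i * (z * (z * c $ 2)) = 0"
        using mv[of "D *\<^sub>v (D *\<^sub>v c)", OF _ i] Dv[OF Dc Dv[OF c(1) Pc]] i c Dc D by (simp add: Dw l_def del: index_mult_mat_vec)
      show ?thesis
        using vandermonde3_zero[of x y z "v x $ i * c $ 0" "v y $ i * c $ 1" "v z $ i * c $ 2"] ne 1 2 3
          vandermonde3_zero[of y z x "v y $ i * c $ 1" "v z $ i * c $ 2" "v x $ i * c $ 0"]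
          vandermonde3_zero[of z x y "v z $ i * c $ 2" "v x $ i * c $ 0" "v y $ i * c $ 1"]
        by (simp only: ac_simps) auto
    qed
    \<comment> \<open>Each eigenvector has a nonzero coordinate, at which the vanishing product
      forces the matching entry of \<open>c\<close> to be 0.\<close>
    have "\<exists>i<3. v t $ i \<noteq> 0" if "t \<in> {x, y, z}" for t
      using v[OF that] by (metis carrier_vecD eq_vecI index_zero_vec)
    then have "c $ 0 = 0" "c $ 1 = 0" "c $ 2 = 0"
      using zero by (metis insertCI mult_eq_0_iff)+
    then have "c = 0\<^sub>v 3"
      using c(1) by (intro eq_vecI) (auto simp: nat_less_3)
    then show False using c by simp
  qed
  then obtain Q where Q: "Q \<in> carrier_mat 3 3" "P * Q = 1\<^sub>m 3" "Q * P = 1\<^sub>m 3"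
    using det_non_zero_imp_unit[OF P, of "()"] by (auto simp: Units_def ring_mat_def)
  have "A = A * (P * Q)" using A Q by simp
  also have "\<dots> = P * D * Q"
    using AP assoc_mult_mat[OF A P Q(1)] by simp
  finally show thesis
    using that[OF P Q] unfolding D_def by blast
qed

subsection \<open>Polynomial dependence on a parameter\<close>

definition polyfun :: "('a::comm_ring_1 \<Rightarrow> 'a) \<Rightarrow> bool" where
  "polyfun f \<longleftrightarrow> (\<exists>p. \<forall>t. f t = poly p t)"

lemma polyfun_const [intro]: "polyfun (\<lambda>t. c)"
  unfolding polyfun_def by (rule exI[of _ "[:c:]"]) simp

lemma polyfun_id [intro]: "polyfun (\<lambda>t. t)"
  unfolding polyfun_def by (rule exI[of _ "[:0, 1:]"]) simp

lemma polyfun_add [intro]: "polyfun f \<Longrightarrow> polyfun g \<Longrightarrow> polyfun (\<lambda>t. f t + g t)"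
  unfolding polyfun_def by (metis poly_add)

lemma polyfun_diff [intro]: "polyfun f \<Longrightarrow> polyfun g \<Longrightarrow> polyfun (\<lambda>t. f t - g t)"
  unfolding polyfun_def by (metis poly_diff)

lemma polyfun_mult [intro]: "polyfun f \<Longrightarrow> polyfun g \<Longrightarrow> polyfun (\<lambda>t. f t * g t)"
  unfolding polyfun_def by (metis poly_mult)

lemma polyfun_divide [intro]: "polyfun f \<Longrightarrow> polyfun (\<lambda>t. f t / c)" for c :: "'a::field"
  using polyfun_mult[of f "\<lambda>_. inverse c"] by (auto simp: field_simps)

lemma polyfun_power [intro]: "polyfun f \<Longrightarrow> polyfun (\<lambda>t. f t ^ n)"
  by (induction n) auto

lemma polyfun_sum [intro]: "(\<And>i. i \<in> I \<Longrightarrow> polyfun (f i)) \<Longrightarrow> polyfun (\<lambda>t. \<Sum>i\<in>I. f i t)"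
  by (induction I rule: infinite_finite_induct) auto

lemma polyfun_prod [intro]: "(\<And>i. i \<in> I \<Longrightarrow> polyfun (f i)) \<Longrightarrow> polyfun (\<lambda>t. \<Prod>i\<in>I. f i t)"
  by (induction I rule: infinite_finite_induct) auto

text \<open>The product of the two polynomials vanishes everywhere, so it is the zero polynomial
  over an infinite field. As the factor for \<open>g\<close> is nonzero, the one for
  \<open>f\<close> is zero, so \<open>f\<close> vanishes at the roots of \<open>g\<close>
  too.\<close>

lemma polyfun_zero_if_zero_off_roots:
  fixes f g :: "'a::field_char_0 \<Rightarrow> 'a"
  assumes "polyfun f" "polyfun g" and "g s \<noteq> 0" and zero: "\<And>t. g t \<noteq> 0 \<Longrightarrow> f t = 0"
  shows "f t = 0"
proof -
  obtain p q where p: "\<And>t. f t = poly p t" and q: "\<And>t. g t = poly q t"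
    using assms unfolding polyfun_def by blast
  have "poly (p * q) t = 0" for t
    using zero[of t] p[of t] q[of t] by auto
  then have "p * q = 0"
    using poly_all_0_iff_0 by blast
  moreover have "q \<noteq> 0"
    using q[of s] \<open>g s \<noteq> 0\<close> by auto
  ultimately show ?thesis
    using p by simp
qed

section \<open>Matrices with polynomial entries and their invariants\<close>

definition polymat :: "nat \<Rightarrow> ('a::comm_ring_1 \<Rightarrow> 'a mat) \<Rightarrow> bool" where
  "polymat n M \<longleftrightarrow> (\<forall>t. M t \<in> carrier_mat n n) \<and> (\<forall>i<n. \<forall>j<n. polyfun (\<lambda>t. M t $$ (i, j)))"

lemma polymatI:
  "(\<And>t. M t \<in> carrier_mat n n) \<Longrightarrow> (\<And>i j. i < n \<Longrightarrow> j < n \<Longrightarrow> polyfun (\<lambda>t. M t $$ (i, j))) \<Longrightarrow> polymat n M"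
  by (simp add: polymat_def)

lemma polymatD:
  assumes "polymat n M"
  shows "M t \<in> carrier_mat n n" "dim_row (M t) = n" "dim_col (M t) = n"
    "i < n \<Longrightarrow> j < n \<Longrightarrow> polyfun (\<lambda>t. M t $$ (i, j))"
  using assms by (auto simp: polymat_def)

lemma polymat_const: "A \<in> carrier_mat n n \<Longrightarrow> polymat n (\<lambda>t. A)"
  by (auto simp: polymat_def)

lemma polymat_mult:
  assumes "polymat n M" "polymat n N"
  shows "polymat n (\<lambda>t. M t * N t)"
proof (rule polymatI)
  fix i j assume ij: "i < n" "j < n"
  have "(\<lambda>t. (M t * N t) $$ (i, j)) = (\<lambda>t. \<Sum>k\<in>{0..<n}. M t $$ (i, k) * N t $$ (k, j))"
    using ij polymatD(2,3)[OF assms(1)] polymatD(2,3)[OF assms(2)] by (simp add: scalar_prod_def)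
  then show "polyfun (\<lambda>t. (M t * N t) $$ (i, j))"
    using polymatD(4)[OF assms(1)] polymatD(4)[OF assms(2)] ij
    by (auto intro!: polyfun_sum polyfun_mult)
qed (rule mult_carrier_mat[OF polymatD(1)[OF assms(1)] polymatD(1)[OF assms(2)]])

lemma polymat_diff:
  assumes "polymat n M" "polymat n N"
  shows "polymat n (\<lambda>t. M t - N t)"
  using assms by (auto intro!: polymatI polyfun_diff simp: polymatD minus_carrier_mat)

lemma polymat_commutator:
  "polymat n M \<Longrightarrow> polymat n N \<Longrightarrow> polymat n (\<lambda>t. commutator (M t) (N t))"
  unfolding commutator_def by (intro polymat_diff polymat_mult)

text \<open>The Leibniz formula is a sum of products of entries.\<close>

lemma polyfun_det:
  assumes "polymat n M"
  shows "polyfun (\<lambda>t. det (M t))"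
proof -
  have "(\<lambda>t. det (M t)) = (\<lambda>t. \<Sum>p | p permutes {0..<n}. signof p * (\<Prod>i = 0..<n. M t $$ (i, p i)))"
    using det_def'[OF polymatD(1)[OF assms]] by simp
  moreover have "polyfun (\<lambda>t. M t $$ (i, p i))" if "p permutes {0..<n}" "i \<in> {0..<n}" for p i
    using that polymatD(4)[OF assms] permutes_in_image[of p "{0..<n}" i] by simp
  ultimately show ?thesis
    by (auto intro!: polyfun_sum polyfun_mult polyfun_prod)
qed

lemma polyfun_mtrace:
  assumes "polymat n M"
  shows "polyfun (\<lambda>t. mtrace (M t))"
  unfolding mtrace_def polymatD(2)[OF assms] using polymatD(4)[OF assms] by auto

lemma polyfun_H: "polymat n M \<Longrightarrow> polyfun (\<lambda>t. H (M t))"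
  unfolding H_def by (intro polyfun_divide polyfun_diff polyfun_power polyfun_mtrace polymat_mult)

lemma polyfun_disc3: "polymat n M \<Longrightarrow> polyfun (\<lambda>t. disc3 (M t))"
  unfolding disc3_def
  by (intro polyfun_add polyfun_diff polyfun_mult polyfun_power polyfun_const polyfun_mtrace polyfun_H polyfun_det)

lemma polyfun_det9:
  assumes "length Ms = 9" "\<And>M. M \<in> set Ms \<Longrightarrow> polymat 3 M"
  shows "polyfun (\<lambda>t. det9 (map (\<lambda>M. M t) Ms))"
  unfolding det9_def
proof (rule polyfun_det[where n = 9], rule polymatI)
  fix r j :: nat assume rj: "r < 9" "j < 9"
  have "polymat 3 (Ms ! j)"
    using assms rj by simp
  from polymatD(4)[OF this, of "r div 3" "r mod 3"]
  show "polyfun (\<lambda>t. mat 9 9 (\<lambda>(r, j). map (\<lambda>M. M t) Ms ! j $$ (r div 3, r mod 3)) $$ (r, j))"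
    using rj assms(1) by (simp add: less_mult_imp_div_less)
qed simp

text \<open>The path \<open>L\<close> runs from \<open>A\<close> to a diagonal matrix with distinct entries, so its discriminant is
  not identically zero and all but finitely many of its points are diagonalizable.\<close>

lemma det9_identity:
  fixes A B :: "'a::{alg_closed_field, field_char_0} mat"
  assumes A: "A \<in> carrier_mat 3 3" and B: "B \<in> carrier_mat 3 3"
  shows "det9 (words9 A B) = - 9 * (det (commutator A B))^2 * H (commutator A B)"
proof -
  \<comment> \<open>\<open>D\<close> is diag(0, 1, 2), whose entries are distinct in characteristic
    zero; its discriminant is 4.\<close>
  define D where "D = mat 3 3 (\<lambda>(i, j). if i = j then of_nat i else 0 :: 'a)"
  define L where "L t = mat 3 3 (\<lambda>(i, j). A $$ (i, j) + t * (D $$ (i, j) - A $$ (i, j)))" for t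
  define f where "f t = det9 (words9 (L t) B) - (- 9) * (det (commutator (L t) B))^2 * H (commutator (L t) B)" for t
  have L: "polymat 3 L" and B': "polymat 3 (\<lambda>t. B)"
    by (auto simp: L_def B intro!: polymatI polymat_const polyfun_add polyfun_mult)
  have L_carrier: "L t \<in> carrier_mat 3 3" for t
    by (simp add: L_def)
  have L0: "L 0 = A" and L1: "L 1 = D"
    using A by (auto simp: L_def D_def intro!: eq_matI)
  have "polyfun (\<lambda>t. det9 (map (\<lambda>M. M t) [\<lambda>t. 1\<^sub>m 3, L, \<lambda>t. L t * L t, \<lambda>t. B, \<lambda>t. B * B, \<lambda>t. L t * B, \<lambda>t. B * L t,
     \<lambda>t. commutator (L t) (commutator (L t) B), \<lambda>t. commutator B (commutator B (L t))]))"
    by (rule polyfun_det9) (auto intro!: polymat_commutator polymat_mult L B' intro: polymat_const)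
  then have "polyfun (\<lambda>t. det9 (words9 (L t) B))"
    by simp
  then have f: "polyfun f"
    unfolding f_def
    by (intro polyfun_diff polyfun_mult polyfun_power polyfun_const polyfun_H[where n = 3]
        polyfun_det[where n = 3] polymat_commutator L B')
  have D: "D \<in> carrier_mat 3 3" by (simp add: D_def)
  have "mtrace D = 3" "det D = 0" "H D = 2"
    unfolding det_3[OF D] H_3[OF D] using D
    by (simp_all add: mtrace_def index_mult_mat3 D_def eval_nat_numeral del: index_mult_mat(1))
  then have "disc3 (L 1) \<noteq> 0"
    unfolding L1 by (simp add: disc3_def)
  moreover have "f t = 0" if d: "disc3 (L t) \<noteq> 0" for t
  proof -
    obtain P Q l where P: "P \<in> carrier_mat 3 3" and Q: "Q \<in> carrier_mat 3 3"
      and PQ: "P * Q = 1\<^sub>m 3" and QP: "Q * P = 1\<^sub>m 3"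
      and Lt: "L t = P * mat 3 3 (\<lambda>(i, j). if i = j then l i else 0) * Q"
      using disc3_nonzero_imp_diagonalizable[OF L_carrier d] by blast
    \<comment> \<open>\<open>B\<close> is expressed in the eigenbasis of \<open>L t\<close>; only
      \<open>L t\<close> becomes diagonal, while \<open>b\<close> is arbitrary.\<close>
    define b where "b i j = (Q * B * P) $$ (i, j)" for i j
    have b: "mat 3 3 (\<lambda>(i, j). b i j) = Q * B * P"
      using P Q by (intro eq_matI) (auto simp: b_def)
    have "P * (Q * B * P) * Q = (P * Q) * B * (P * Q)"
      using P Q B by (simp add: assoc_mult_mat[of _ 3 3 _ 3 _ 3])
    then have "B = P * mat 3 3 (\<lambda>(i, j). b i j) * Q"
      using B by (simp add: PQ b)
    with det9_identity_conj[OF P Q _ _ PQ QP det9_words9_diagonal[of l b]]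
    have "det9 (words9 (L t) B) = - 9 * (det (commutator (L t) B))^2 * H (commutator (L t) B)"
      unfolding Lt by simp
    then show ?thesis
      by (simp add: f_def)
  qed
  \<comment> \<open>The point 0 gives back \<open>A\<close>, whose own discriminant may
    vanish.\<close>
  ultimately have "f 0 = 0"
    by (rule polyfun_zero_if_zero_off_roots[OF f polyfun_disc3[OF L]])
  then show ?thesis
    by (simp add: f_def L0 eq_neg_iff_add_eq_0)
qed

section \<open>From a nonzero determinant to a basis\<close>

lemma is_basis_M3_if_det9_nonzero:
  fixes Ms :: "'a::field mat list"
  assumes len: "length Ms = 9" and Ms: "set Ms \<subseteq> carrier_mat 3 3" and d: "det9 Ms \<noteq> 0"
  shows "is_basis_M3 Ms"
proof -
  define N where "N = mat 9 9 (\<lambda>(r, j). (Ms ! j) $$ (r div 3, r mod 3))"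
  have N: "N \<in> carrier_mat 9 9" and dN: "det N \<noteq> 0"
    using d by (simp_all add: N_def det9_def)
  \<comment> \<open>In row-major coordinates a linear combination is \<open>N\<close> applied to its
    coefficient vector: a trivial kernel gives independence, and an inverse of \<open>N\<close>
    gives spanning.\<close>
  have comb: "lin_comb9 c Ms $$ (r div 3, r mod 3) = (N *\<^sub>v vec 9 c) $ r" if "r < 9" for c r
    using that by (simp add: lin_comb9_def N_def scalar_prod_def atLeast0LessThan less_mult_imp_div_less mult.commute)
  have index: "\<exists>r<9. i = r div 3 \<and> j = r mod 3" if "i < 3" "j < 3" for i j :: nat
    using that by (intro exI[of _ "3 * i + j"]) auto
  have "c j = 0" if zero: "lin_comb9 c Ms = 0\<^sub>m 3 3" and j: "j < 9" for c j
  proof -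
    have "N *\<^sub>v vec 9 c = 0\<^sub>v 9"
      by (rule eq_vecI) (use N in \<open>simp_all add: comb[symmetric] zero less_mult_imp_div_less del: index_mult_mat_vec\<close>)
    then have "vec 9 c = 0\<^sub>v 9"
      using det_0_iff_vec_prod_zero_field[OF N] dN vec_carrier by blast
    then show ?thesis
      using j by (metis index_vec index_zero_vec(1))
  qed
  moreover have "\<exists>c. M = lin_comb9 c Ms" if M: "M \<in> carrier_mat 3 3" for M
  proof -
    obtain N' where N': "N' \<in> carrier_mat 9 9" "N * N' = 1\<^sub>m 9"
      using det_non_zero_imp_unit[OF N dN, of "()"] by (auto simp: Units_def ring_mat_def)
    define w where "w = vec 9 (\<lambda>r. M $$ (r div 3, r mod 3))"
    define c where "c j = (N' *\<^sub>v w) $ j" for j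
    have w: "w \<in> carrier_vec 9" by (simp add: w_def)
    have "vec 9 c = N' *\<^sub>v w"
      using N' by (intro eq_vecI) (auto simp: c_def)
    then have Nc: "N *\<^sub>v vec 9 c = w"
      using assoc_mult_mat_vec[OF N N'(1) w] N' w by simp
    have "M = lin_comb9 c Ms"
    proof (rule eq_matI)
      fix i j assume "i < dim_row (lin_comb9 c Ms)" "j < dim_col (lin_comb9 c Ms)"
      then obtain r where "r < 9" "i = r div 3" "j = r mod 3"
        using index[of i j] by (auto simp: lin_comb9_def)
      then show "M $$ (i, j) = lin_comb9 c Ms $$ (i, j)"
        using comb[of r c] by (simp add: Nc w_def)
    qed (use M in \<open>simp_all add: lin_comb9_def\<close>)
    then show ?thesis by blast
  qed
  ultimately show ?thesis
    using len Ms by (auto simp: is_basis_M3_def)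
qed

theorem theorem7:
  fixes A B :: "'a::{alg_closed_field, field_char_0} mat"
  assumes "A \<in> carrier_mat 3 3" and "B \<in> carrier_mat 3 3"
  shows "det9 [1\<^sub>m 3, A, A * A, B, B * B, A * B, B * A,
               commutator A (commutator A B), commutator B (commutator B A)]
           = - 9 * (det (commutator A B))^2 * H (commutator A B)
         \<and> (det (commutator A B) \<noteq> 0 \<longrightarrow> H (commutator A B) \<noteq> 0 \<longrightarrow>
            is_basis_M3 [1\<^sub>m 3, A, A * A, B, B * B, A * B, B * A,
               commutator A (commutator A B), commutator B (commutator B A)])"
proof (intro conjI impI)
  show id: "det9 (words9 A B) = - 9 * (det (commutator A B))^2 * H (commutator A B)"
    by (rule det9_identity[OF assms])
  assume "det (commutator A B) \<noteq> 0" "H (commutator A B) \<noteq> 0"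
  \<comment> \<open>Characteristic zero enters through the factor 9 being nonzero.\<close>
  then have "det9 (words9 A B) \<noteq> 0"
    unfolding id by simp
  then show "is_basis_M3 (words9 A B)"
    using assms by (intro is_basis_M3_if_det9_nonzero) auto
qed

end
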